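(* Let $G$, $\boldsymbol{\xi}$, $A_G$, $B_G$ and Newton's method be as described in the context, and let the assumptions (i)–(iii) there be satisfied. Suppose we are able to improve the initial estimate $\varepsilon_0$ (the error of the initial guess) by a factor of $2^{-n}$, where $n\in\mathbb{N}$, i.e. Newton's method is started with initial error $2^{-n}\varepsilon_0$. Then an upper bound $M_{iter}=M_{iter}(n)$ of the iteration count required for Newton's method to achieve a fixed tolerance $\varepsilon_{tol}$ (i.e. error $\|\mathbf{y}^{(k)}-\boldsymbol{\xi}\|_\infty$ at most $\varepsilon_{tol}$) is given by $$M_{iter}=\max\{0,\ \lceil C_1-\log_2|C_2-n|\,\rceil\}.$$ The constants $C_1$ and $C_2$ depend on the properties of the first- and second-order partial derivatives of $G$ (i.e. on the norm of the inverse Jacobian and the norm of the Hessian, as measured by $B_G$ and $A_G$). Furthermore, $C_1$ depends on the desired tolerance $\varepsilon_{tol}$ and $C_2$ depends on the initial guess (through $\varepsilon_0$), but neither is affected by $n$. Here $n>C_2$ is needed for the convergence of the Newton iteration.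
   Context: Let $N\in\mathbb{N}$ and consider a system of nonlinear equations $G(\mathbf{y})=\mathbf{0}$, $\mathbf{y}\in\mathbb{R}^N$, with $G$ taking values in $\mathbb{R}^N$. Newton's method is the recursion $\mathbf{y}^{(k+1)}=\mathbf{y}^{(k)}-D_{\mathbf{y}}G(\mathbf{y}^{(k)})^{-1}G(\mathbf{y}^{(k)})$, $k=0,1,2,\dots$, where $D_{\mathbf{y}}G$ is the Jacobian matrix of $G$. Assumptions: (i) The system has a unique solution $\boldsymbol{\xi}$, i.e. $G(\boldsymbol{\xi})=\mathbf{0}$. Furthermore, there is an open neighbourhood $N_{neighbour}(\boldsymbol{\xi})$ of $\boldsymbol{\xi}$ in which $G$ is defined and continuous and all second-order partial derivatives of $G$ are defined and continuous, and $D_{\mathbf{y}}G(\boldsymbol{\xi})$ is nonsingular. (ii) The initialisation of the Newton iterates lies in this neighbourhood, $\mathbf{y}^{(0)}\in N_{neighbour}(\boldsymbol{\xi})$. (iii) The Jacobian matrix $D_{\mathbf{y}}G$ exists and is nonsingular at each element of the sequence $\mathbf{y}^{(k)}$, $k=0,1,\dots$. Write $\varepsilon_k=\|\mathbf{y}^{(k)}-\boldsymbol{\xi}\|_\infty$ for the error of the $k$-th iterate. It is recalled as a known theorem that, under these assumptions, $\varepsilon_{k+1}\le C\varepsilon_k^2$ with $C=\tfrac12N^2A_GB_G$, where $$A_G=\max_{1\le i,j,l\le N}\ \max_{\mathbf{y}\in\bar B_\epsilon(\boldsymbol{\xi})}\left|\frac{\partial^2 G_i}{\partial y_j\partial y_l}(\mathbf{y})\right|,\qquad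 B_G=\max_{\mathbf{y}\in\bar B_\epsilon(\boldsymbol{\xi})}\left\|[D_{\mathbf{y}}G(\mathbf{y})]^{-1}\right\|_\infty ,$$ for some $\epsilon>0$ such that the closed ball $\bar B_\epsilon(\boldsymbol{\xi})$ of radius $\epsilon$ centred at $\boldsymbol{\xi}$ is contained in $N_{neighbour}(\boldsymbol{\xi})$.
   Formalization: The starting iterate is assumed to lie in the closed max-norm ball over which A_G and B_G are taken, not merely in the neighbourhood of ξ (otherwise Newton may cycle outside the ball and the bound fails); n > C_2 is taken as a hypothesis of the bound. *)

theory Defs
  imports "HOL-Analysis.Analysis"
begin

definition has_partial :: "'n::finite \<Rightarrow> (real^'n \<Rightarrow> real) \<Rightarrow> real^'n \<Rightarrow> bool" where
  "has_partial j f y \<longleftrightarrow> (\<lambda>t. f (y + t *\<^sub>R axis j 1)) field_differentiable (at 0)"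

definition partial :: "'n::finite \<Rightarrow> (real^'n \<Rightarrow> real) \<Rightarrow> real^'n \<Rightarrow> real" where
  "partial j f y = deriv (\<lambda>t. f (y + t *\<^sub>R axis j 1)) 0"

abbreviation partial2 ::
    "(real^'n::finite \<Rightarrow> real^'n) \<Rightarrow> 'n \<Rightarrow> 'n \<Rightarrow> 'n \<Rightarrow> real^'n \<Rightarrow> real" where
  "partial2 G i j l \<equiv> partial j (partial l (\<lambda>y. G y $ i))"

definition second_partials_on :: "(real^'n::finite \<Rightarrow> real^'n) \<Rightarrow> (real^'n) set \<Rightarrow> bool" where
  "second_partials_on G U \<longleftrightarrow>
     (\<forall>i j l. (\<forall>y\<in>U. has_partial l (\<lambda>y. G y $ i) y
                    \<and> has_partial j (partial l (\<lambda>y. G y $ i)) y)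
            \<and> continuous_on U (partial2 G i j l))"

text \<open>The matrix norm subordinate to the maximum norm.\<close>

definition matrix_infnorm :: "real^'n^'n::finite \<Rightarrow> real" where
  "matrix_infnorm A = (SUP v\<in>UNIV - {0}. infnorm (A *v v) / infnorm v)"

definition infnorm_cball :: "real^'n::finite \<Rightarrow> real \<Rightarrow> (real^'n) set" where
  "infnorm_cball x r = {y. infnorm (y - x) \<le> r}"

text \<open>The suprema below are the maxima \<open>A\<^sub>G\<close> and \<open>B\<^sub>G\<close> as soon as \<open>G\<close> has continuous second
  partial derivatives near the (compact) ball and, for \<open>B\<^sub>G\<close>, the Jacobian matrix is
  invertible on the ball.\<close>

definition A_bound :: "(real^'n::finite \<Rightarrow> real^'n) \<Rightarrow> real^'n \<Rightarrow> real \<Rightarrow> real" where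
  "A_bound G \<xi> r =
     Sup {\<bar>partial2 G i j l y\<bar> | i j l y. y \<in> infnorm_cball \<xi> r}"

definition B_bound :: "(real^'n::finite \<Rightarrow> real^'n) \<Rightarrow> real^'n \<Rightarrow> real \<Rightarrow> real" where
  "B_bound G \<xi> r =
     (SUP y\<in>infnorm_cball \<xi> r. matrix_infnorm (matrix_inv (jacobian G (at y))))"

definition newton_sequence ::
    "(real^'n::finite \<Rightarrow> real^'n) \<Rightarrow> (nat \<Rightarrow> real^'n) \<Rightarrow> bool" where
  "newton_sequence G y \<longleftrightarrow>
     (\<forall>k. y (Suc k) = y k - matrix_inv (jacobian G (at (y k))) *v G (y k))"

definition newton_assm_i ::
    "(real^'n::finite \<Rightarrow> real^'n) \<Rightarrow> real^'n \<Rightarrow> (real^'n) set \<Rightarrow> bool" where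
  "newton_assm_i G \<xi> U \<longleftrightarrow>
     (\<forall>x. G x = 0 \<longleftrightarrow> x = \<xi>) \<and> open U \<and> \<xi> \<in> U \<and>
     continuous_on U G \<and> second_partials_on G U \<and> invertible (jacobian G (at \<xi>))"

definition newton_assm_ii :: "(real^'n::finite) set \<Rightarrow> (nat \<Rightarrow> real^'n) \<Rightarrow> bool" where
  "newton_assm_ii U y \<longleftrightarrow> y 0 \<in> U"

definition newton_assm_iii ::
    "(real^'n::finite \<Rightarrow> real^'n) \<Rightarrow> (nat \<Rightarrow> real^'n) \<Rightarrow> bool" where
  "newton_assm_iii G y \<longleftrightarrow>
     (\<forall>k. G differentiable (at (y k)) \<and> invertible (jacobian G (at (y k))))"

text \<open>Admissible radii of the ball over which \<open>A\<^sub>G\<close> and \<open>B\<^sub>G\<close> are taken. Invertibility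
  of the Jacobian matrix on the ball is what makes \<open>B\<^sub>G\<close> meaningful.\<close>

definition admissible_radius ::
    "(real^'n::finite \<Rightarrow> real^'n) \<Rightarrow> real^'n \<Rightarrow> (real^'n) set \<Rightarrow> real \<Rightarrow> bool" where
  "admissible_radius G \<xi> U r \<longleftrightarrow>
     r > 0 \<and> infnorm_cball \<xi> r \<subseteq> U \<and>
     (\<forall>y\<in>infnorm_cball \<xi> r. invertible (jacobian G (at y)))"

text \<open>The constant \<open>C\<close> in the quadratic error estimate
  \<open>\<epsilon>\<^sub>k\<^sub>+\<^sub>1 \<le> C \<epsilon>\<^sub>k\<^sup>2\<close>, with \<open>A\<close>, \<open>B\<close> standing for \<open>A\<^sub>G\<close>, \<open>B\<^sub>G\<close>.\<close>

definition quad_const :: "nat \<Rightarrow> real \<Rightarrow> real \<Rightarrow> real" where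
  "quad_const N A B = 1/2 * (real N)\<^sup>2 * A * B"

definition M_iter :: "real \<Rightarrow> real \<Rightarrow> nat \<Rightarrow> int" where
  "M_iter c1 c2 n = max 0 \<lceil>c1 - log 2 \<bar>c2 - real n\<bar>\<rceil>"

end

theory Submission
  imports Defs
begin

text \<open>
  Write \<open>\<epsilon>\<^sub>k\<close> for the error of the \<open>k\<close>-th iterate in the maximum norm. Two facts give the bound.

  The error decays quadratically. Expand \<open>G\<close> to second order about the iterate \<open>y\<close> and evaluate at
  the root \<open>\<xi>\<close>: with \<open>J\<close> the Jacobian matrix at \<open>y\<close>, \<open>0 = G y + J (\<xi> - y) + w\<close>, where \<open>w\<close> is at most
  \<open>N\<^sup>2 A / 2\<close> times the square of the error because its components are double sums of \<open>N\<^sup>2\<close> second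
  derivatives (\<open>taylor_remainder_bound\<close>). Multiplying \<open>G y + J (\<xi> - y) = - w\<close> by the inverse of \<open>J\<close>
  gives \<open>\<xi> - y'\<close> on the left, where \<open>y'\<close> is the next iterate, so \<open>\<epsilon>\<^sub>k\<^sub>+\<^sub>1 \<le> C \<epsilon>\<^sub>k\<^sup>2\<close> with
  \<open>C = N\<^sup>2 A B / 2\<close> (\<open>newton_step_quadratic\<close>). This needs the
  suprema \<open>A\<close> and \<open>B\<close> to be genuine upper bounds. Both follow from compactness of the ball: for \<open>A\<close>
  the second partial derivatives are continuous there; for \<open>B\<close>, the continuous function
  \<open>(y, v) \<mapsto> \<parallel>J(y) v\<parallel>\<close> attains a positive minimum on the product of the ball with the unit sphere,
  and its reciprocal bounds the inverses uniformly (\<open>jacobian_uniform_lower_bound\<close>).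

  The count is then read off. With \<open>c > 0\<close> and \<open>c \<epsilon>\<^sub>0 < 1\<close> the iterates never leave the ball and
  \<open>c \<epsilon>\<^sub>k \<le> (c \<epsilon>\<^sub>0) ^ (2 ^ k)\<close> (\<open>quadratic_recursion_decay\<close>). This is below \<open>1\<close>, which
  settles the case \<open>c tol \<ge> 1\<close>. If \<open>c tol < 1\<close>, then, taking binary logarithms twice,
  the right-hand side is at most \<open>c tol\<close> as soon as
  \<open>k \<ge> log 2 (- log 2 (c tol)) - log 2 (- log 2 (c \<epsilon>\<^sub>0))\<close> (\<open>iteration_count_suffices\<close>). If the initial
  error is \<open>2 powr (- n)\<close> times \<open>e > 0\<close>, then \<open>log 2 (c \<epsilon>\<^sub>0) = log 2 (c e) - n\<close>. So \<open>C\<^sub>1\<close> is the first double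
  logarithm, \<open>C\<^sub>2\<close> is \<open>log 2 (c e)\<close>, and \<open>n > C\<^sub>2\<close> says exactly \<open>c \<epsilon>\<^sub>0 < 1\<close>.
  If \<open>e = 0\<close>, the iteration starts at the root and the quadratic estimate keeps it there.

  The constant \<open>C\<close> vanishes when all second derivatives vanish on the ball, as for affine \<open>G\<close>, and then
  its logarithm carries no information.
  Any positive \<open>c \<ge> C\<close> satisfies the same quadratic estimate, so \<open>c = 1\<close> is used in that case and
  \<open>c = C\<close> otherwise.
\<close>

section \<open>The maximum norm\<close>

lemma infnorm_le_componentwise:
  fixes x :: "real^'n"
  assumes "\<And>i. \<bar>x $ i\<bar> \<le> b"
  shows "infnorm x \<le> b"
  unfolding infnorm_cart by (rule cSup_least) (use assms in auto)

lemma compact_infnorm_cball: "compact (infnorm_cball (\<xi> :: real^'n) r)"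
  unfolding compact_eq_bounded_closed
proof
  have "norm y \<le> norm \<xi> + sqrt DIM(real^'n) * r" if "infnorm (y - \<xi>) \<le> r" for y
  proof -
    have "norm y \<le> norm \<xi> + norm (y - \<xi>)"
      using norm_triangle_ineq[of \<xi> "y - \<xi>"] by simp
    also have "norm (y - \<xi>) \<le> sqrt DIM(real^'n) * infnorm (y - \<xi>)"
      by (rule norm_le_infnorm)
    also have "\<dots> \<le> sqrt DIM(real^'n) * r"
      using that by (intro mult_left_mono) auto
    finally show ?thesis by simp
  qed
  then show "bounded (infnorm_cball \<xi> r)"
    unfolding bounded_iff infnorm_cball_def by blast
  show "closed (infnorm_cball \<xi> r)"
    unfolding infnorm_cball_def
    by (intro closed_Collect_le continuous_intros)
qed

lemma infnorm_sphere_compact: "compact {v :: real^'n. infnorm v = 1}"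
proof -
  have "{v :: real^'n. infnorm v = 1} = infnorm_cball 0 1 \<inter> {v. infnorm v = 1}"
    by (auto simp: infnorm_cball_def)
  moreover have "closed {v :: real^'n. infnorm v = 1}"
    by (intro closed_Collect_eq continuous_intros)
  ultimately show ?thesis
    by (metis compact_Int_closed compact_infnorm_cball)
qed

text \<open>The supremum defining \<^const>\<open>matrix_infnorm\<close> is over a bounded set, because the maximum norm
  and the Euclidean norm are equivalent and a matrix is bounded for the latter.\<close>

lemma bdd_above_matrix_infnorm_quotients:
  fixes M :: "real^'n^'n"
  shows "bdd_above ((\<lambda>v. infnorm (M *v v) / infnorm v) ` (UNIV - {0}))"
proof -
  obtain K where K: "K \<ge> 0" "\<And>x. norm (M *v x) \<le> norm x * K"
    using bounded_linear.nonneg_bounded[OF matrix_vector_mul_bounded_linear[of M]] by blast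
  have "infnorm (M *v v) / infnorm v \<le> sqrt DIM(real^'n) * K" if "v \<in> UNIV - {0}" for v
  proof -
    have "infnorm (M *v v) \<le> norm v * K"
      using infnorm_le_norm[of "M *v v"] K(2)[of v] by linarith
    also have "\<dots> \<le> (sqrt DIM(real^'n) * infnorm v) * K"
      by (intro mult_right_mono norm_le_infnorm K)
    finally show ?thesis
      using that by (simp add: divide_le_eq infnorm_pos_lt mult_ac)
  qed
  then show ?thesis by (rule bdd_aboveI2)
qed

lemma infnorm_matrix_vector_le:
  fixes M :: "real^'n^'n"
  shows "infnorm (M *v v) \<le> matrix_infnorm M * infnorm v"
proof (cases "v = 0")
  case True
  then show ?thesis by (simp add: infnorm_0)
next
  case False
  then have "infnorm (M *v v) / infnorm v \<le> matrix_infnorm M"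
    unfolding matrix_infnorm_def
    by (intro cSUP_upper bdd_above_matrix_infnorm_quotients) auto
  with False show ?thesis by (simp add: divide_le_eq infnorm_pos_lt)
qed

lemma matrix_infnorm_leI:
  fixes M :: "real^'n^'n"
  assumes "\<And>v. infnorm (M *v v) \<le> b * infnorm v"
  shows "matrix_infnorm M \<le> b"
  unfolding matrix_infnorm_def
proof (rule cSUP_least)
  have "axis undefined 1 \<noteq> (0 :: real^'n)"
    by (simp add: axis_eq_0_iff)
  then show "UNIV - {0 :: real^'n} \<noteq> {}" by blast
  show "infnorm (M *v v) / infnorm v \<le> b" if "v \<in> UNIV - {0}" for v
    using assms[of v] that by (simp add: divide_le_eq infnorm_pos_lt)
qed

lemma matrix_infnorm_nonneg: "0 \<le> matrix_infnorm (M :: real^'n^'n)"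
proof -
  have "0 \<le> infnorm (M *v axis undefined 1)" by (rule infnorm_pos_le)
  also have "\<dots> \<le> matrix_infnorm M * infnorm (axis undefined 1 :: real^'n)"
    by (rule infnorm_matrix_vector_le)
  finally show ?thesis
    by (metis axis_eq_0_iff infnorm_pos_lt zero_le_mult_iff linorder_not_less zero_neq_one)
qed

lemma matrix_inv_inverse:
  fixes M :: "real^'n^'n"
  assumes "invertible M"
  shows "M ** matrix_inv M = mat 1" "matrix_inv M ** M = mat 1"
  using someI_ex[of "\<lambda>A'. M ** A' = mat 1 \<and> A' ** M = mat 1"] assms
  unfolding invertible_def matrix_inv_def by auto


section \<open>Partial derivatives and the Jacobian matrix\<close>

lemma partial_has_derivative_along_axis:
  assumes "has_partial j f (y + t *\<^sub>R axis j 1)"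
  shows "((\<lambda>s. f (y + s *\<^sub>R axis j 1)) has_real_derivative partial j f (y + t *\<^sub>R axis j 1)) (at t)"
proof -
  have "((\<lambda>s. f (y + t *\<^sub>R axis j 1 + s *\<^sub>R axis j 1)) has_real_derivative
      partial j f (y + t *\<^sub>R axis j 1)) (at 0)"
    using assms unfolding has_partial_def partial_def by (rule field_differentiable_derivI)
  then show ?thesis
    using DERIV_shift[of "\<lambda>s. f (y + s *\<^sub>R axis j 1)" _ 0 t]
    by (simp add: algebra_simps)
qed

text \<open>Walk from \<open>x\<close> to \<open>x + h\<close> parallel to the axes, one coordinate at a time, and apply the mean value
  theorem on each leg. After the coordinates in \<open>S\<close>, the error of the linear prediction is at most
  one term \<open>e * norm h\<close> per leg. The path stays within distance \<open>norm h\<close> of \<open>x\<close> because every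
  coordinate of its displacement lies between \<open>0\<close> and that of \<open>h\<close>.\<close>

lemma partial_increment_bound:
  fixes f :: "real^'n \<Rightarrow> real" and S :: "'n set"
  assumes has: "\<And>z j. norm (z - x) \<le> norm h \<Longrightarrow> has_partial j f z"
    and close: "\<And>z j. norm (z - x) \<le> norm h \<Longrightarrow> \<bar>partial j f z - p j\<bar> \<le> e"
  shows "\<bar>f (x + (\<chi> i. if i \<in> S then h $ i else 0)) - f x - (\<Sum>j\<in>S. p j * h $ j)\<bar>
           \<le> card S * (e * norm h)"
  using finite[of S]
proof (induction S)
  case empty
  have "(\<chi> i. 0) = (0 :: real^'n)" by (simp add: vec_eq_iff)
  then show ?case by simp
next
  case (insert j S)
  define a where "a = x + (\<chi> i. if i \<in> S then h $ i else 0)"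
  define g where "g t = f (a + t *\<^sub>R axis j 1) - p j * t" for t
  have near: "norm (a + t *\<^sub>R axis j 1 - x) \<le> norm h" if "t \<in> closed_segment 0 (h $ j)" for t
  proof (rule norm_le_componentwise_cart)
    fix i
    have "\<bar>t\<bar> \<le> \<bar>h $ j\<bar>"
      using that by (auto simp: closed_segment_eq_real_ivl split: if_splits)
    then show "norm ((a + t *\<^sub>R axis j 1 - x) $ i) \<le> norm (h $ i)"
      using insert.hyps by (auto simp: a_def axis_def)
  qed
  have "norm (g (h $ j) - g 0) \<le> e * norm (h $ j - 0)"
  proof (rule field_differentiable_bound)
    show "convex (closed_segment 0 (h $ j))" by simp
    fix t assume t: "t \<in> closed_segment 0 (h $ j)"
    show "(g has_field_derivative (partial j f (a + t *\<^sub>R axis j 1) - p j))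
        (at t within closed_segment 0 (h $ j))"
    proof -
      have "((\<lambda>s. f (a + s *\<^sub>R axis j 1)) has_real_derivative
          partial j f (a + t *\<^sub>R axis j 1)) (at t)"
        by (rule partial_has_derivative_along_axis[OF has[OF near[OF t]]])
      then have "(g has_field_derivative (partial j f (a + t *\<^sub>R axis j 1) - p j)) (at t)"
        unfolding g_def by (auto intro!: derivative_eq_intros)
      then show ?thesis by (rule DERIV_subset) simp
    qed
    show "norm (partial j f (a + t *\<^sub>R axis j 1) - p j) \<le> e"
      using close[OF near[OF t]] by simp
  qed auto
  moreover have "e \<ge> 0" using close[of x j] by auto
  ultimately have step: "\<bar>g (h $ j) - g 0\<bar> \<le> e * norm h"
    using mult_left_mono[OF component_le_norm_cart[of h j], of e] by simp
  have "a + h $ j *\<^sub>R axis j 1 = x + (\<chi> i. if i \<in> insert j S then h $ i else 0)"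
    using insert.hyps by (auto simp: a_def axis_def vec_eq_iff)
  with step insert.IH insert.hyps show ?case
    by (simp add: g_def a_def[symmetric] algebra_simps)
qed

text \<open>Near \<open>x\<close> all the partial derivatives differ from their values at \<open>x\<close> by less than \<open>e / N\<close>; the
  previous lemma sums these deviations over the \<open>N\<close> axes.\<close>

lemma continuous_partials_imp_has_derivative:
  fixes f :: "real^'n \<Rightarrow> real"
  assumes U: "open U" "x \<in> U"
    and has: "\<And>j y. y \<in> U \<Longrightarrow> has_partial j f y"
    and cont: "\<And>j. continuous_on U (partial j f)"
  shows "(f has_derivative (\<lambda>h. \<Sum>j\<in>UNIV. partial j f x * h $ j)) (at x)"
  unfolding has_derivative_at_alt
proof (intro conjI allI impI)
  show "bounded_linear (\<lambda>h. \<Sum>j\<in>UNIV. partial j f x * h $ j)"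
    by (intro bounded_linear_sum bounded_linear_const_mult bounded_linear_vec_nth)
  fix e :: real assume "0 < e"
  define e' where "e' = e / CARD('n)"
  have e': "e' > 0" using \<open>0 < e\<close> by (simp add: e'_def)
  have "eventually (\<lambda>z. \<forall>j. \<bar>partial j f z - partial j f x\<bar> < e') (at x)"
  proof (rule eventually_all_finite)
    fix j
    have "(partial j f \<longlongrightarrow> partial j f x) (at x)"
      using cont[of j] U by (simp add: continuous_on_eq_continuous_at isCont_def)
    then show "eventually (\<lambda>z. \<bar>partial j f z - partial j f x\<bar> < e') (at x)"
      using e' by (auto dest: tendstoD simp: dist_real_def)
  qed
  moreover have "eventually (\<lambda>z. z \<in> U) (at x)"
    using U by (rule eventually_at_in_open')
  ultimately have "eventually (\<lambda>z. z \<in> U \<and> (\<forall>j. \<bar>partial j f z - partial j f x\<bar> < e')) (at x)"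
    by eventually_elim auto
  then obtain d where d: "d > 0"
    "\<And>z. z \<noteq> x \<Longrightarrow> dist z x < d \<Longrightarrow> z \<in> U \<and> (\<forall>j. \<bar>partial j f z - partial j f x\<bar> < e')"
    unfolding eventually_at by auto
  show "\<exists>d>0. \<forall>y. norm (y - x) < d \<longrightarrow>
      norm (f y - f x - (\<Sum>j\<in>UNIV. partial j f x * (y - x) $ j)) \<le> e * norm (y - x)"
  proof (intro exI[of _ d] conjI allI impI d(1))
    fix y assume y: "norm (y - x) < d"
    have near: "z \<in> U \<and> \<bar>partial j f z - partial j f x\<bar> \<le> e'"
      if "norm (z - x) \<le> norm (y - x)" for z j
      using d(2)[of z] that y e' U by (cases "z = x") (auto simp: dist_norm less_imp_le)
    have "\<bar>f (x + (\<chi> i. if i \<in> UNIV then (y - x) $ i else 0)) - f x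
        - (\<Sum>j\<in>UNIV. partial j f x * (y - x) $ j)\<bar> \<le> card (UNIV :: 'n set) * (e' * norm (y - x))"
      by (rule partial_increment_bound) (use near has in blast)+
    moreover have "x + (\<chi> i. if i \<in> UNIV then (y - x) $ i else 0) = y"
      by (simp add: vec_eq_iff)
    ultimately show "norm (f y - f x - (\<Sum>j\<in>UNIV. partial j f x * (y - x) $ j)) \<le> e * norm (y - x)"
      by (simp add: e'_def)
  qed
qed

context
  fixes G :: "real^'n \<Rightarrow> real^'n" and U :: "(real^'n) set"
  assumes U: "open U" and C2: "second_partials_on G U"
begin

text \<open>The hypotheses only concern partial derivatives. Total differentiability is recovered by going
  down one order at a time: the first partials have continuous partials, so they are differentiable,
  hence continuous, and therefore \<open>G\<close> itself is differentiable.\<close>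

lemma partial_has_derivative:
  assumes "x \<in> U"
  shows "(partial l (\<lambda>y. G y $ i) has_derivative
    (\<lambda>h. \<Sum>j\<in>UNIV. partial2 G i j l x * h $ j)) (at x)"
  using C2 by (intro continuous_partials_imp_has_derivative[OF U assms])
    (auto simp: second_partials_on_def)

lemma continuous_on_partial: "continuous_on U (partial l (\<lambda>y. G y $ i))"
  using partial_has_derivative U
  by (auto simp: continuous_on_eq_continuous_at intro: has_derivative_continuous)

lemma component_has_derivative:
  assumes "x \<in> U"
  shows "((\<lambda>y. G y $ i) has_derivative
    (\<lambda>h. \<Sum>l\<in>UNIV. partial l (\<lambda>y. G y $ i) x * h $ l)) (at x)"
  using C2 by (intro continuous_partials_imp_has_derivative[OF U assms] continuous_on_partial)
    (auto simp: second_partials_on_def)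

lemma jacobian_eq_partials:
  assumes "x \<in> U"
  shows "jacobian G (at x) = (\<chi> i l. partial l (\<lambda>y. G y $ i) x)"
proof -
  have "(G has_derivative (\<lambda>h. (\<chi> i l. partial l (\<lambda>y. G y $ i) x) *v h)) (at x)"
    using component_has_derivative[OF assms]
    by (auto simp: has_derivative_componentwise_within[where f = G] Basis_vec_def inner_axis
        matrix_vector_mult_def)
  then show ?thesis
    by (simp add: jacobian_def frechet_derivative_at[symmetric] matrix_of_matrix_vector_mul)
qed

lemma jacobian_component:
  assumes "x \<in> U"
  shows "(jacobian G (at x) *v h) $ i = (\<Sum>l\<in>UNIV. partial l (\<lambda>y. G y $ i) x * h $ l)"
  by (simp add: jacobian_eq_partials[OF assms] matrix_vector_mult_def)

text \<open>Apply the one-variable Taylor theorem with Lagrange remainder to each component of \<open>G\<close> along the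
  segment from \<open>y\<close> to \<open>y + h\<close>. The second derivative in the direction \<open>h\<close> is a sum of \<open>N\<^sup>2\<close> terms, each
  at most \<open>A * (infnorm h)\<^sup>2\<close>.\<close>

lemma taylor_remainder_bound:
  assumes seg: "\<And>t. 0 \<le> t \<Longrightarrow> t \<le> 1 \<Longrightarrow> y + t *\<^sub>R h \<in> U"
    and A: "\<And>t i j l. 0 \<le> t \<Longrightarrow> t \<le> 1 \<Longrightarrow> \<bar>partial2 G i j l (y + t *\<^sub>R h)\<bar> \<le> A"
  shows "infnorm (G (y + h) - G y - jacobian G (at y) *v h) \<le> 1/2 * (real CARD('n))\<^sup>2 * A * (infnorm h)\<^sup>2"
proof (rule infnorm_le_componentwise)
  fix i
  define \<phi>1 where "\<phi>1 t = (\<Sum>l\<in>UNIV. partial l (\<lambda>y. G y $ i) (y + t *\<^sub>R h) * h $ l)" for t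
  define \<phi>2 where
    "\<phi>2 t = (\<Sum>l\<in>UNIV. (\<Sum>j\<in>UNIV. partial2 G i j l (y + t *\<^sub>R h) * h $ j) * h $ l)" for t
  define D where "D m = (if m = 0 then (\<lambda>t. G (y + t *\<^sub>R h) $ i) else if m = 1 then \<phi>1 else \<phi>2)"
    for m :: nat
  have line: "((\<lambda>t. y + t *\<^sub>R h) has_derivative (\<lambda>s. s *\<^sub>R h)) (at t)" for t
    by (auto intro!: derivative_eq_intros)
  have d0: "DERIV (\<lambda>t. G (y + t *\<^sub>R h) $ i) t :> \<phi>1 t" if "0 \<le> t" "t \<le> 1" for t
    unfolding has_field_derivative_def
    by (rule has_derivative_eq_rhs[OF has_derivative_compose[OF line
          component_has_derivative[OF seg[OF that], of i]]])
      (simp add: fun_eq_iff \<phi>1_def sum_distrib_left mult_ac)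
  have d1: "DERIV \<phi>1 t :> \<phi>2 t" if "0 \<le> t" "t \<le> 1" for t
  proof -
    have "DERIV (\<lambda>t. partial l (\<lambda>y. G y $ i) (y + t *\<^sub>R h)) t
        :> (\<Sum>j\<in>UNIV. partial2 G i j l (y + t *\<^sub>R h) * h $ j)" for l
      unfolding has_field_derivative_def
      by (rule has_derivative_eq_rhs[OF has_derivative_compose[OF line
            partial_has_derivative[OF seg[OF that], of l i]]])
        (simp add: fun_eq_iff sum_distrib_left mult_ac)
    then show ?thesis
      unfolding \<phi>1_def \<phi>2_def by (auto intro!: DERIV_sum DERIV_cmult_right)
  qed
  have "\<exists>t::real. 0 < t \<and> t < 1 \<and>
      G (y + 1 *\<^sub>R h) $ i = (\<Sum>m<2. (D m 0 / fact m) * 1 ^ m) + (D 2 t / fact 2) * 1 ^ 2"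
    by (rule Maclaurin[where f = "\<lambda>t. G (y + t *\<^sub>R h) $ i"])
      (auto simp: D_def less_2_cases_iff d0 d1)
  then obtain t where t: "0 < t" "t < 1" and
    eq: "G (y + h) $ i = G y $ i + \<phi>1 0 + \<phi>2 t / 2"
    by (auto simp: D_def numeral_2_eq_2)
  have "\<phi>1 0 = (jacobian G (at y) *v h) $ i"
    using seg[of 0] by (simp add: \<phi>1_def jacobian_component)
  with eq have rem: "(G (y + h) - G y - jacobian G (at y) *v h) $ i = \<phi>2 t / 2"
    by simp
  have "\<bar>\<phi>2 t\<bar> \<le> (\<Sum>l\<in>(UNIV :: 'n set). \<Sum>j\<in>(UNIV :: 'n set). A * infnorm h * infnorm h)"
    unfolding \<phi>2_def sum_distrib_right
  proof (intro order_trans[OF sum_abs] sum_mono)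
    fix l j :: 'n
    have "A \<ge> 0" using A[of 0 i j l] by auto
    then show "\<bar>partial2 G i j l (y + t *\<^sub>R h) * h $ j * h $ l\<bar> \<le> A * infnorm h * infnorm h"
      unfolding abs_mult using t
      by (intro mult_mono A component_le_infnorm_cart) (auto simp: infnorm_pos_le)
  qed
  then show "\<bar>(G (y + h) - G y - jacobian G (at y) *v h) $ i\<bar>
      \<le> 1/2 * (real CARD('n))\<^sup>2 * A * (infnorm h)\<^sup>2"
    unfolding rem by (simp add: power2_eq_square mult_ac)
qed

text \<open>By homogeneity in \<open>v\<close> it suffices to treat unit vectors. There the quantity to be bounded is
  continuous on a compact set, so it attains its minimum, which is positive because an invertible
  matrix kills no unit vector. This bounds the inverses uniformly without a formula for them.\<close>

lemma jacobian_uniform_lower_bound: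
  assumes K: "compact K" "K \<noteq> {}" "K \<subseteq> U"
    and inv: "\<And>y. y \<in> K \<Longrightarrow> invertible (jacobian G (at y))"
  obtains m where "m > 0" "\<And>y v. y \<in> K \<Longrightarrow> m * infnorm v \<le> infnorm (jacobian G (at y) *v v)"
proof -
  define S where "S = {v :: real^'n. infnorm v = 1}"
  define F where "F = (\<lambda>(y, v). infnorm (\<chi> i. \<Sum>l\<in>UNIV. partial l (\<lambda>y. G y $ i) y * v $ l))"
  have F: "F (y, v) = infnorm (jacobian G (at y) *v v)" if "y \<in> K" for y v
  proof -
    have "(\<chi> i. \<Sum>l\<in>UNIV. partial l (\<lambda>y. G y $ i) y * v $ l) = jacobian G (at y) *v v"
      using that K by (auto simp: vec_eq_iff jacobian_component)
    then show ?thesis by (simp add: F_def)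
  qed
  have "axis undefined 1 \<noteq> (0 :: real^'n)" by (simp add: axis_eq_0_iff)
  then have "(1 / infnorm (axis undefined 1 :: real^'n)) *\<^sub>R (axis undefined 1) \<in> S"
    using infnorm_pos_lt[of "axis undefined 1 :: real^'n"] by (simp add: S_def infnorm_mul)
  then have ne: "K \<times> S \<noteq> {}" using K by auto
  have "continuous_on (K \<times> S) (\<lambda>p. partial l (\<lambda>y. G y $ i) (fst p))" for i l
    by (rule continuous_on_compose2[OF continuous_on_partial[of l i]])
      (use K in \<open>auto intro: continuous_intros\<close>)
  then have "continuous_on (K \<times> S) F"
    unfolding F_def case_prod_beta by (intro continuous_intros) auto
  moreover have "compact (K \<times> S)"
    unfolding S_def by (intro compact_Times K infnorm_sphere_compact)
  ultimately obtain p where p: "p \<in> K \<times> S" "\<And>q. q \<in> K \<times> S \<Longrightarrow> F p \<le> F q"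
    using continuous_attains_inf[OF _ ne] by blast
  obtain y0 v0 where [simp]: "p = (y0, v0)" and y0: "y0 \<in> K" and v0: "infnorm v0 = 1"
    using p by (cases p) (auto simp: S_def)
  have "jacobian G (at y0) *v v0 \<noteq> 0"
  proof
    assume "jacobian G (at y0) *v v0 = 0"
    then have "matrix_inv (jacobian G (at y0)) *v (jacobian G (at y0) *v v0) = 0" by simp
    then have "v0 = 0"
      by (simp add: matrix_vector_mul_assoc matrix_inv_inverse[OF inv[OF y0]])
    with v0 show False by (simp add: infnorm_0)
  qed
  then have pos: "F p > 0" using F[OF y0] by (simp add: infnorm_pos_lt)
  have "F p * infnorm v \<le> infnorm (jacobian G (at y) *v v)" if y: "y \<in> K" for y v
  proof (cases "v = 0")
    case False
    then have v: "infnorm v > 0" by (simp add: infnorm_pos_lt)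
    then have "(1 / infnorm v) *\<^sub>R v \<in> S" by (simp add: S_def infnorm_mul)
    then have "F p \<le> F (y, (1 / infnorm v) *\<^sub>R v)" using p y by auto
    also have "\<dots> = infnorm (jacobian G (at y) *v v) / infnorm v"
      using v by (simp add: F[OF y] matrix_vector_mult_scaleR infnorm_mul)
    finally show ?thesis using v by (simp add: le_divide_eq)
  qed (simp add: infnorm_0)
  with pos show ?thesis by (rule that)
qed

lemma partial2_le_A_bound:
  assumes sub: "infnorm_cball \<xi> r \<subseteq> U" and y: "y \<in> infnorm_cball \<xi> r"
  shows "\<bar>partial2 G i j l y\<bar> \<le> A_bound G \<xi> r"
proof -
  have "bdd_above ((\<lambda>y. \<bar>partial2 G i j l y\<bar>) ` infnorm_cball \<xi> r)" for i j l
  proof -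
    have "continuous_on (infnorm_cball \<xi> r) (\<lambda>y. \<bar>partial2 G i j l y\<bar>)"
      using C2 sub unfolding second_partials_on_def
      by (intro continuous_on_rabs) (blast intro: continuous_on_subset)
    then show ?thesis
      by (intro bounded_imp_bdd_above compact_imp_bounded compact_continuous_image
          compact_infnorm_cball)
  qed
  then have "bdd_above (\<Union>(i, j, l)\<in>UNIV. (\<lambda>y. \<bar>partial2 G i j l y\<bar>) ` infnorm_cball \<xi> r)"
    by (subst bdd_above_UN) auto
  moreover have "(\<Union>(i, j, l)\<in>UNIV. (\<lambda>y. \<bar>partial2 G i j l y\<bar>) ` infnorm_cball \<xi> r)
      = {\<bar>partial2 G i j l y\<bar> | i j l y. y \<in> infnorm_cball \<xi> r}"
    by auto
  ultimately show ?thesis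
    unfolding A_bound_def using y by (intro cSup_upper) auto
qed

lemma matrix_infnorm_inverse_le_B_bound:
  assumes adm: "admissible_radius G \<xi> U r" and y: "y \<in> infnorm_cball \<xi> r"
  shows "matrix_infnorm (matrix_inv (jacobian G (at y))) \<le> B_bound G \<xi> r"
proof -
  have sub: "infnorm_cball \<xi> r \<subseteq> U"
    and inv: "\<And>z. z \<in> infnorm_cball \<xi> r \<Longrightarrow> invertible (jacobian G (at z))"
    using adm by (auto simp: admissible_radius_def)
  obtain m where m: "m > 0"
    "\<And>z v. z \<in> infnorm_cball \<xi> r \<Longrightarrow> m * infnorm v \<le> infnorm (jacobian G (at z) *v v)"
    using jacobian_uniform_lower_bound[OF compact_infnorm_cball _ sub inv] y by blast
  have "matrix_infnorm (matrix_inv (jacobian G (at z))) \<le> 1 / m"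
    if z: "z \<in> infnorm_cball \<xi> r" for z
  proof (rule matrix_infnorm_leI)
    fix v
    have "m * infnorm (matrix_inv (jacobian G (at z)) *v v) \<le> infnorm v"
      using m(2)[OF z, of "matrix_inv (jacobian G (at z)) *v v"]
      by (simp add: matrix_vector_mul_assoc matrix_inv_inverse[OF inv[OF z]])
    then show "infnorm (matrix_inv (jacobian G (at z)) *v v) \<le> 1 / m * infnorm v"
      using m(1) by (simp add: le_divide_eq mult.commute)
  qed
  then show ?thesis
    unfolding B_bound_def by (intro cSUP_upper y bdd_aboveI2)
qed


section \<open>Convergence of the Newton iteration\<close>

text \<open>Since \<open>G \<xi> = 0\<close>, the new error is the inverse Jacobian matrix applied to the Taylor remainder of
  the expansion about \<open>y\<close> evaluated at \<open>\<xi>\<close>. The segment from \<open>y\<close> to \<open>\<xi>\<close> stays in the ball, so the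
  remainder is controlled by the bound on the second derivatives over the ball.\<close>

lemma newton_step_quadratic:
  assumes adm: "admissible_radius G \<xi> U r" and root: "G \<xi> = 0"
    and y: "y \<in> infnorm_cball \<xi> r"
  shows "infnorm (y - matrix_inv (jacobian G (at y)) *v G y - \<xi>)
    \<le> quad_const CARD('n) (A_bound G \<xi> r) (B_bound G \<xi> r) * (infnorm (y - \<xi>))\<^sup>2"
proof -
  define J where "J = jacobian G (at y)"
  define w where "w = G \<xi> - G y - J *v (\<xi> - y)"
  have sub: "infnorm_cball \<xi> r \<subseteq> U" and inv: "invertible J"
    using adm y by (auto simp: admissible_radius_def J_def)
  have seg: "y + t *\<^sub>R (\<xi> - y) \<in> infnorm_cball \<xi> r" if "0 \<le> t" "t \<le> 1" for t
  proof -
    have "y + t *\<^sub>R (\<xi> - y) - \<xi> = (1 - t) *\<^sub>R (y - \<xi>)"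
      by (simp add: algebra_simps)
    moreover have "(1 - t) * infnorm (y - \<xi>) \<le> 1 * infnorm (y - \<xi>)"
      using that by (intro mult_right_mono) (auto simp: infnorm_pos_le)
    ultimately show ?thesis
      using y that by (simp add: infnorm_cball_def infnorm_mul)
  qed
  have w: "infnorm w \<le> 1/2 * (real CARD('n))\<^sup>2 * A_bound G \<xi> r * (infnorm (y - \<xi>))\<^sup>2"
    using taylor_remainder_bound[of y "\<xi> - y" "A_bound G \<xi> r"] seg sub
      partial2_le_A_bound[OF sub seg]
    by (auto simp: w_def J_def infnorm_sub[of \<xi> y])
  have "matrix_inv J *v (J *v (\<xi> - y)) = \<xi> - y"
    by (simp add: matrix_vector_mul_assoc matrix_inv_inverse[OF inv])
  then have "y - matrix_inv J *v G y - \<xi> = matrix_inv J *v w"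
    using matrix_vector_mult_diff_distrib[of "matrix_inv J" 0 "G y"]
    by (simp add: w_def root matrix_vector_mult_diff_distrib)
  then have "infnorm (y - matrix_inv J *v G y - \<xi>) \<le> matrix_infnorm (matrix_inv J) * infnorm w"
    by (simp add: infnorm_matrix_vector_le)
  also have "\<dots> \<le> B_bound G \<xi> r * (1/2 * (real CARD('n))\<^sup>2 * A_bound G \<xi> r * (infnorm (y - \<xi>))\<^sup>2)"
    using matrix_infnorm_inverse_le_B_bound[OF adm y] matrix_infnorm_nonneg[of "matrix_inv J"] w
    by (intro mult_mono) (auto simp: J_def infnorm_pos_le)
  finally show ?thesis
    by (simp add: J_def quad_const_def mult_ac)
qed

end

text \<open>The normalised error \<open>c * \<epsilon> k\<close> is at most squared in each step. The recursion is only available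
  inside the ball of radius \<open>r\<close>, so the induction carries along \<open>\<epsilon> k \<le> \<epsilon> 0\<close>, which holds because
  \<open>c * \<epsilon> k \<le> c * \<epsilon> 0 < 1\<close> makes each step contracting.\<close>

lemma quadratic_recursion_decay:
  fixes \<epsilon> :: "nat \<Rightarrow> real"
  assumes c: "c > 0" and nonneg: "\<And>k. 0 \<le> \<epsilon> k"
    and step: "\<And>k. \<epsilon> k \<le> r \<Longrightarrow> \<epsilon> (Suc k) \<le> c * (\<epsilon> k)\<^sup>2"
    and start: "\<epsilon> 0 \<le> r" "c * \<epsilon> 0 < 1"
  shows "c * \<epsilon> k \<le> (c * \<epsilon> 0) ^ (2 ^ k)"
proof -
  have "\<epsilon> k \<le> \<epsilon> 0 \<and> c * \<epsilon> k \<le> (c * \<epsilon> 0) ^ (2 ^ k)"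
  proof (induction k)
    case (Suc k)
    then have le: "\<epsilon> (Suc k) \<le> c * (\<epsilon> k)\<^sup>2"
      using start by (intro step) simp
    have small: "c * \<epsilon> k \<le> c * \<epsilon> 0"
      using Suc c by (intro mult_left_mono) auto
    have "c * (\<epsilon> k)\<^sup>2 = (c * \<epsilon> k) * \<epsilon> k" by (simp add: power2_eq_square)
    also have "\<dots> \<le> 1 * \<epsilon> k"
      using small start nonneg by (intro mult_right_mono) auto
    finally have "\<epsilon> (Suc k) \<le> \<epsilon> 0" using le Suc by linarith
    moreover have "c * \<epsilon> (Suc k) \<le> (c * \<epsilon> k)\<^sup>2"
      using mult_left_mono[OF le, of c] c by (simp add: power2_eq_square mult_ac)
    moreover have "(c * \<epsilon> k)\<^sup>2 \<le> ((c * \<epsilon> 0) ^ (2 ^ k))\<^sup>2"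
      using Suc c nonneg by (intro power_mono) auto
    ultimately show ?case by (simp add: power_mult[symmetric] mult.commute)
  qed simp
  then show ?thesis by blast
qed

text \<open>This is \<open>2 ^ k * (- log 2 q) \<ge> - log 2 s\<close> after a further logarithm; both inner logarithms are
  positive because \<open>q\<close> and \<open>s\<close> are less than \<open>1\<close>.\<close>

lemma iteration_count_suffices:
  fixes q s :: real
  assumes q: "0 < q" "q < 1" and s: "0 < s" "s < 1"
    and k: "log 2 (- log 2 s) - log 2 (- log 2 q) \<le> real k"
  shows "q ^ (2 ^ k) \<le> s"
proof -
  have lq: "- log 2 q > 0" and ls: "- log 2 s > 0"
    using q s by simp_all
  have "log 2 (- log 2 s) \<le> log 2 (2 ^ k * (- log 2 q))"
    using k lq log_mult_pos[of "2 ^ k" "- log 2 q" 2] by (simp add: log_nat_power)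
  then have "- log 2 s \<le> 2 ^ k * (- log 2 q)"
    using lq ls by (subst (asm) log_le_cancel_iff) (auto simp: mult_pos_neg)
  then have "log 2 (q ^ (2 ^ k)) \<le> log 2 s"
    using q by (simp add: log_nat_power)
  then show ?thesis using q s by simp
qed

theorem theorem3p2:
  shows "\<exists>C1 C2 :: real \<Rightarrow> real \<Rightarrow> real \<Rightarrow> real.
    (\<forall>A B. A > 0 \<and> B > 0 \<longrightarrow>
       (\<forall>e>0. C2 A B e = log 2 (quad_const CARD('n::finite) A B * e)) \<and>
       (\<forall>t>0. quad_const CARD('n) A B * t < 1 \<longrightarrow>
          C1 A B t = log 2 (- log 2 (quad_const CARD('n) A B * t)))) \<and>
    (\<forall>(G :: real^'n \<Rightarrow> real^'n) \<xi> U r guess tol n y c1 c2.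
       newton_assm_i G \<xi> U \<longrightarrow>
       admissible_radius G \<xi> U r \<longrightarrow>
       tol > 0 \<longrightarrow>
       c1 = C1 (A_bound G \<xi> r) (B_bound G \<xi> r) tol \<longrightarrow>
       c2 = C2 (A_bound G \<xi> r) (B_bound G \<xi> r) (infnorm (guess - \<xi>)) \<longrightarrow>
       newton_sequence G y \<longrightarrow>
       newton_assm_ii U y \<longrightarrow>
       newton_assm_iii G y \<longrightarrow>
       y 0 \<in> infnorm_cball \<xi> r \<longrightarrow>
       infnorm (y 0 - \<xi>) = 2 powr (- real n) * infnorm (guess - \<xi>) \<longrightarrow>
       real n > c2 \<longrightarrow>
       (\<forall>k. M_iter c1 c2 n \<le> int k \<longrightarrow> infnorm (y k - \<xi>) \<le> tol))"
proof -
  \<comment> \<open>The value 1 covers a vanishing quadratic constant: the quadratic estimate survives any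
    enlargement of the constant, and a positive one is needed to take logarithms.\<close>
  define Q where "Q A B =
    (if quad_const CARD('n) A B > 0 then quad_const CARD('n) A B else 1)" for A B
  have Q_pos: "Q A B > 0" and Q_ge: "quad_const CARD('n) A B \<le> Q A B" for A B
    by (auto simp: Q_def)
  have Q_eq: "Q A B = quad_const CARD('n) A B" if "A > 0" "B > 0" for A B
    using that by (simp add: Q_def quad_const_def)
  show ?thesis
  proof (rule exI[of _ "\<lambda>A B t. log 2 (- log 2 (Q A B * t))"],
      rule exI[of _ "\<lambda>A B e. log 2 (Q A B * e)"], intro conjI allI impI)
    fix G :: "real^'n \<Rightarrow> real^'n" and \<xi> U r guess tol n y c1 c2 k
    assume i: "newton_assm_i G \<xi> U" and adm: "admissible_radius G \<xi> U r" and tol: "tol > 0"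
      and c1: "c1 = log 2 (- log 2 (Q (A_bound G \<xi> r) (B_bound G \<xi> r) * tol))"
      and c2: "c2 = log 2 (Q (A_bound G \<xi> r) (B_bound G \<xi> r) * infnorm (guess - \<xi>))"
      and newton: "newton_sequence G y" and y0: "y 0 \<in> infnorm_cball \<xi> r"
      and start: "infnorm (y 0 - \<xi>) = 2 powr (- real n) * infnorm (guess - \<xi>)"
      and n: "real n > c2" and k: "M_iter c1 c2 n \<le> int k"
    define c where "c = Q (A_bound G \<xi> r) (B_bound G \<xi> r)"
    define \<epsilon> where "\<epsilon> j = infnorm (y j - \<xi>)" for j
    have c: "c > 0" by (simp add: c_def Q_pos)
    have U: "open U" "second_partials_on G U" and root: "G \<xi> = 0"
      using i by (auto simp: newton_assm_i_def)
    have step: "\<epsilon> (Suc j) \<le> c * (\<epsilon> j)\<^sup>2" if "\<epsilon> j \<le> r" for j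
    proof -
      have "\<epsilon> (Suc j) \<le> quad_const CARD('n) (A_bound G \<xi> r) (B_bound G \<xi> r) * (\<epsilon> j)\<^sup>2"
        using newton_step_quadratic[OF U adm root, of "y j"] newton that
        by (simp add: \<epsilon>_def newton_sequence_def infnorm_cball_def)
      also have "\<dots> \<le> c * (\<epsilon> j)\<^sup>2"
        unfolding c_def by (intro mult_right_mono Q_ge) simp
      finally show ?thesis .
    qed
    have decay: "c * \<epsilon> k \<le> (c * \<epsilon> 0) ^ (2 ^ k)" if "c * \<epsilon> 0 < 1"
      using that y0
      by (intro quadratic_recursion_decay[where r = r] c step)
        (auto simp: \<epsilon>_def infnorm_pos_le infnorm_cball_def)
    have "c * \<epsilon> k \<le> c * tol"
    proof (cases "guess = \<xi>")
      case True
      then have "\<epsilon> 0 = 0" using start by (simp add: \<epsilon>_def infnorm_0)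
      then have "c * \<epsilon> k \<le> 0" using decay by (simp add: zero_power)
      also have "0 \<le> c * tol" using c tol by simp
      finally show ?thesis .
    next
      case False
      then have e: "infnorm (guess - \<xi>) > 0" by (simp add: infnorm_pos_lt)
      then have pos: "c * \<epsilon> 0 > 0" using c start by (simp add: \<epsilon>_def)
      have log_start: "log 2 (c * \<epsilon> 0) = c2 - real n"
        using c e by (simp add: \<epsilon>_def start c2 c_def[symmetric] log_mult_pos)
      then have "log 2 (c * \<epsilon> 0) < 0" using n by simp
      then have less: "c * \<epsilon> 0 < 1" using pos by simp
      show ?thesis
      proof (cases "c * tol < 1")
        case True
        have "log 2 (- log 2 (c * tol)) - log 2 (- log 2 (c * \<epsilon> 0)) \<le> real k"
        proof -
          have "\<lceil>c1 - log 2 \<bar>c2 - real n\<bar>\<rceil> \<le> int k"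
            using k by (simp add: M_iter_def)
          then have "c1 - log 2 \<bar>c2 - real n\<bar> \<le> real k"
            by (simp add: ceiling_le_iff)
          then show ?thesis using n by (simp add: log_start c1 c_def[symmetric])
        qed
        then have "(c * \<epsilon> 0) ^ (2 ^ k) \<le> c * tol"
          by (intro iteration_count_suffices) (use pos less True c tol in auto)
        then show ?thesis using decay[OF less] by linarith
      next
        case False
        \<comment> \<open>The normalised error never exceeds 1, so such a large tolerance is met from the start,
          whatever value the double logarithm takes.\<close>
        have "(c * \<epsilon> 0) ^ (2 ^ k) \<le> 1"
          using pos less by (intro power_le_one) auto
        then show ?thesis using False decay[OF less] by linarith
      qed
    qed
    then show "infnorm (y k - \<xi>) \<le> tol" using c by (simp add: \<epsilon>_def)
  qed (simp_all add: Q_eq)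
qed

end
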